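(* Let $K$ be a commutative ring with unity. Let $\mathbf{M}$ be an $\mathrm{OI}$-module over an $\mathrm{OI}$-algebra $\mathbf{A}$ over $K$ (or an $\mathrm{FI}$-module over an $\mathrm{FI}$-algebra $\mathbf{A}$ over $K$, respectively), and let $\Pi=\mathrm{Inc}(\mathbb{N})$ (or $\Pi=\mathrm{Sym}(\infty)$, respectively). If $\mathbf{M}$ is noetherian, then $\lim\mathbf{M}$ is $\Pi$-noetherian, that is, every $\Pi$-invariant $K[\mathbf{A}]$-submodule of $\lim\mathbf{M}$ can be generated by finitely many $\Pi$-orbits.
   Context: $\mathbb{N}$ is the set of positive integers, $[n]=\{1,\dots,n\}$, $[0]=\emptyset$. $\mathrm{FI}$ is the category of finite sets and injective maps; $\mathrm{OI}$ is the category of totally ordered finite sets and order-preserving injective maps. An $\mathrm{OI}$-algebra (resp. $\mathrm{FI}$-algebra) over $K$ is a covariant functor $\mathbf{A}$ from $\mathrm{OI}$ (resp. $\mathrm{FI}$) to commutative associative unital $K$-algebras with $\mathbf{A}(\emptyset)=K$; write $\mathbf{A}_S=\mathbf{A}(S)$, $\mathbf{A}_n=\mathbf{A}([n])$. An $\mathrm{OI}$-module (resp. $\mathrm{FI}$-module) over $\mathbf{A}$ is a covariant functor $\mathbf{M}$ from $\mathrm{OI}$ (resp. $\mathrm{FI}$) to $K$-modules such that each $\mathbf{M}_S=\mathbf{M}(S)$ is also an $\mathbf{A}_S$-module and, for all morphisms $\tilde\varepsilon\colon\tilde S\to S$, $\varepsilon\colon S\to T$ and all $a\in\mathbf{A}_{\tilde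 S}$, $q\in\mathbf{M}_S$, one has $\mathbf{M}(\varepsilon)(\mathbf{A}(\tilde\varepsilon)(a)\cdot q)=\mathbf{A}(\varepsilon\circ\tilde\varepsilon)(a)\cdot\mathbf{M}(\varepsilon)(q)$. A submodule is a family of $\mathbf{A}_S$-submodules $\mathbf{N}_S\subseteq\mathbf{M}_S$ stable under all $\mathbf{M}(\varepsilon)$. $\mathbf{M}$ is finitely generated if some finite subset of $\coprod_{n\ge0}\mathbf{M}_n$ is not contained in any proper submodule; it is noetherian if every submodule is finitely generated. With $\iota_{m,n}\colon[m]\to[n]$, $j\mapsto j$ ($m\le n$), set $K[\mathbf{A}]=\varinjlim\mathbf{A}_n$ (direct system $(\mathbf{A}_n,\mathbf{A}(\iota_{m,n}))$, a $K$-algebra) and $\lim\mathbf{M}=\varinjlim\mathbf{M}_n$ (direct system $(\mathbf{M}_n,\mathbf{M}(\iota_{m,n}))$); $[\,\cdot\,]$ denotes classes in colimits. $\lim\mathbf{M}$ is a $K[\mathbf{A}]$-module via $[a]\cdot[q]=[\mathbf{A}(\iota_{m,k})(a)\cdot\mathbf{M}(\iota_{n,k})(q)]$ for $a\in\mathbf{A}_m$, $q\in\mathbf{M}_n$, $k=\max\{m,n\}$. $\mathrm{Inc}(\mathbb{N})=\{\pi\colon\mathbb{N}\to\mathbb{N} : \pi(i)<\pi(i+1)\text{ for all }i\ge1\}$ (a monoid under composition), $\mathrm{Sym}(\infty)=\bigcup_{n\in\mathbb{N}}\mathrm{Sym}(n)$, where $\mathrm{Sym}(n)\subset\mathrm{Sym}(n+1)$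 is the stabilizer of $n+1$. For $m\ge1$ and $\pi\in\mathrm{Inc}(\mathbb{N})$ let $\varepsilon_{\pi,m}\colon[m]\to[\pi(m)]$, $j\mapsto\pi(j)$; for $\pi\in\mathrm{Sym}(\infty)$ let $\varepsilon_{\pi,m}\colon[m]\to[l_m]$, $j\mapsto\pi(j)$, where $l_m$ is the least integer with $\pi([m])\subseteq[l_m]$. The monoid/group $\Pi$ acts on $\lim\mathbf{M}$ by $\pi\cdot[q]=[\mathbf{M}(\varepsilon_{\pi,m})(q)]$ for $q\in\mathbf{M}_m$, $m\ge 1$. *)

theory Defs
  imports "HOL-Algebra.Module" "HOL-Combinatorics.Permutations"
begin

section \<open>The index categories OI and FI\<close>

text \<open>
  HOL has no type of all sets, so the objects of both categories are carried by finite subsets of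
  \<^typ>\<open>nat\<close>.  This is a small category equivalent to the category of all (totally ordered) finite
  sets, and it contains the intervals \<^term>\<open>{1..n::nat}\<close>.  A morphism is represented by a function
  that is \<^const>\<open>undefined\<close> off its source, so that equal maps are equal functions.
\<close>

record 'o ix_cat =
  Obj :: "'o set"
  pts :: "'o \<Rightarrow> nat set"
  Hom :: "'o \<Rightarrow> 'o \<Rightarrow> (nat \<Rightarrow> nat) set"
  std :: "nat \<Rightarrow> 'o"

definition OI :: "(nat set \<times> nat rel) ix_cat" where
  "OI = \<lparr> Obj = {(S, r). finite S \<and> linear_order_on S r},
          pts = fst,
          Hom = (\<lambda>(S, r) (T, s). {f \<in> S \<rightarrow>\<^sub>E T. inj_on f S \<and> (\<forall>(x, y) \<in> r. (f x, f y) \<in> s)}),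
          std = (\<lambda>n. ({1..n}, {(x, y). x \<in> {1..n} \<and> y \<in> {1..n} \<and> x \<le> y})) \<rparr>"

definition FI :: "nat set ix_cat" where
  "FI = \<lparr> Obj = {S. finite S},
          pts = (\<lambda>S. S),
          Hom = (\<lambda>S T. {f \<in> S \<rightarrow>\<^sub>E T. inj_on f S}),
          std = (\<lambda>n. {1..n}) \<rparr>"

section \<open>Algebras and modules over an index category\<close>

definition alg_hom ::
  "('k, 'z) ring_scheme \<Rightarrow> ('k, 'a) module \<Rightarrow> ('k, 'b) module \<Rightarrow> ('a \<Rightarrow> 'b) set" where
  "alg_hom K R S = {f \<in> ring_hom R S.
     \<forall>k \<in> carrier K. \<forall>x \<in> carrier R. f (k \<odot>\<^bsub>R\<^esub> x) = k \<odot>\<^bsub>S\<^esub> f x}"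

definition lin_hom ::
  "('k, 'z) ring_scheme \<Rightarrow> ('k, 'a) module \<Rightarrow> ('k, 'b) module \<Rightarrow> ('a \<Rightarrow> 'b) set" where
  "lin_hom K P Q = {f \<in> carrier P \<rightarrow> carrier Q.
     (\<forall>x \<in> carrier P. \<forall>y \<in> carrier P. f (x \<oplus>\<^bsub>P\<^esub> y) = f x \<oplus>\<^bsub>Q\<^esub> f y) \<and>
     (\<forall>k \<in> carrier K. \<forall>x \<in> carrier P. f (k \<odot>\<^bsub>P\<^esub> x) = k \<odot>\<^bsub>Q\<^esub> f x)}"

record ('o, 'k, 'a) alg_functor =
  alg_ob :: "'o \<Rightarrow> ('k, 'a) module"
  alg_map :: "'o \<Rightarrow> 'o \<Rightarrow> (nat \<Rightarrow> nat) \<Rightarrow> 'a \<Rightarrow> 'a"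

text \<open>
  The condition that the value on the empty set is \<open>K\<close> is read up to the canonical map: the
  structure map \<open>k \<mapsto> k \<cdot> 1\<close> is bijective.
\<close>

locale ix_algebra =
  fixes C :: "'o ix_cat" and K :: "('k, 'z) ring_scheme" and A :: "('o, 'k, 'a) alg_functor"
  assumes alg: "S \<in> Obj C \<Longrightarrow> algebra K (alg_ob A S)"
    and map_hom: "\<lbrakk>S \<in> Obj C; T \<in> Obj C; f \<in> Hom C S T\<rbrakk>
      \<Longrightarrow> alg_map A S T f \<in> alg_hom K (alg_ob A S) (alg_ob A T)"
    and map_id: "\<lbrakk>S \<in> Obj C; a \<in> carrier (alg_ob A S)\<rbrakk>
      \<Longrightarrow> alg_map A S S (\<lambda>x\<in>pts C S. x) a = a"
    and map_comp: "\<lbrakk>S \<in> Obj C; T \<in> Obj C; U \<in> Obj C; f \<in> Hom C S T; g \<in> Hom C T U;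
        a \<in> carrier (alg_ob A S)\<rbrakk>
      \<Longrightarrow> alg_map A S U (compose (pts C S) g f) a = alg_map A T U g (alg_map A S T f a)"
    and empty: "\<lbrakk>S \<in> Obj C; pts C S = {}\<rbrakk>
      \<Longrightarrow> bij_betw (\<lambda>k. k \<odot>\<^bsub>alg_ob A S\<^esub> \<one>\<^bsub>alg_ob A S\<^esub>) (carrier K) (carrier (alg_ob A S))"

text \<open>
  \<open>kmod M S\<close> is the \<open>K\<close>-module attached to \<open>S\<close>, and \<open>act M S\<close> is the scalar multiplication making
  its additive group a module over the algebra attached to \<open>S\<close>.  The identity
  \<open>(k \<cdot> 1) \<cdot> q = k \<cdot> q\<close> linking the two structures is not needed and not assumed.
\<close>

record ('o, 'k, 'a, 'm) mod_functor =
  kmod :: "'o \<Rightarrow> ('k, 'm) module"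
  act :: "'o \<Rightarrow> 'a \<Rightarrow> 'm \<Rightarrow> 'm"
  mod_map :: "'o \<Rightarrow> 'o \<Rightarrow> (nat \<Rightarrow> nat) \<Rightarrow> 'm \<Rightarrow> 'm"

definition amod :: "('o, 'k, 'a, 'm) mod_functor \<Rightarrow> 'o \<Rightarrow> ('a, 'm) module" where
  "amod M S = \<lparr> carrier = carrier (kmod M S),
                monoid.mult = monoid.mult (kmod M S), one = one (kmod M S),
                zero = zero (kmod M S), add = add (kmod M S), smult = act M S \<rparr>"

locale ix_module = ix_algebra C K A
  for C :: "'o ix_cat" and K :: "('k, 'z) ring_scheme" and A :: "('o, 'k, 'a) alg_functor" +
  fixes M :: "('o, 'k, 'a, 'm) mod_functor"
  assumes kmodule: "S \<in> Obj C \<Longrightarrow> module K (kmod M S)"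
    and amodule: "S \<in> Obj C \<Longrightarrow> module (alg_ob A S) (amod M S)"
    and mod_map_hom: "\<lbrakk>S \<in> Obj C; T \<in> Obj C; f \<in> Hom C S T\<rbrakk>
      \<Longrightarrow> mod_map M S T f \<in> lin_hom K (kmod M S) (kmod M T)"
    and mod_map_id: "\<lbrakk>S \<in> Obj C; q \<in> carrier (kmod M S)\<rbrakk>
      \<Longrightarrow> mod_map M S S (\<lambda>x\<in>pts C S. x) q = q"
    and mod_map_comp: "\<lbrakk>S \<in> Obj C; T \<in> Obj C; U \<in> Obj C; f \<in> Hom C S T; g \<in> Hom C T U;
        q \<in> carrier (kmod M S)\<rbrakk>
      \<Longrightarrow> mod_map M S U (compose (pts C S) g f) q = mod_map M T U g (mod_map M S T f q)"
    and mod_map_act: "\<lbrakk>R \<in> Obj C; S \<in> Obj C; T \<in> Obj C; e \<in> Hom C R S; f \<in> Hom C S T;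
        a \<in> carrier (alg_ob A R); q \<in> carrier (kmod M S)\<rbrakk>
      \<Longrightarrow> mod_map M S T f (act M S (alg_map A R S e a) q)
          = act M T (alg_map A R T (compose (pts C R) f e) a) (mod_map M S T f q)"

definition ix_submodule ::
  "'o ix_cat \<Rightarrow> ('o, 'k, 'a) alg_functor \<Rightarrow> ('o, 'k, 'a, 'm) mod_functor \<Rightarrow> ('o \<Rightarrow> 'm set) \<Rightarrow> bool"
where
  "ix_submodule C A M N \<longleftrightarrow>
     (\<forall>S \<in> Obj C. submodule (N S) (alg_ob A S) (amod M S)) \<and>
     (\<forall>S \<in> Obj C. \<forall>T \<in> Obj C. \<forall>f \<in> Hom C S T. mod_map M S T f ` N S \<subseteq> N T)"

definition restrict_module ::
  "('o, 'k, 'a, 'm) mod_functor \<Rightarrow> ('o \<Rightarrow> 'm set) \<Rightarrow> ('o, 'k, 'a, 'm) mod_functor" where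
  "restrict_module M N = M\<lparr>kmod := \<lambda>S. (kmod M S)\<lparr>carrier := N S\<rparr>\<rparr>"

definition fin_gen ::
  "'o ix_cat \<Rightarrow> ('o, 'k, 'a) alg_functor \<Rightarrow> ('o, 'k, 'a, 'm) mod_functor \<Rightarrow> bool" where
  "fin_gen C A M \<longleftrightarrow>
     (\<exists>G. finite G \<and> G \<subseteq> (SIGMA n:UNIV. carrier (kmod M (std C n))) \<and>
       \<not> (\<exists>N. ix_submodule C A M N \<and> (\<exists>S \<in> Obj C. N S \<noteq> carrier (kmod M S)) \<and>
              G \<subseteq> (SIGMA n:UNIV. N (std C n))))"

definition noetherian_module ::
  "'o ix_cat \<Rightarrow> ('o, 'k, 'a) alg_functor \<Rightarrow> ('o, 'k, 'a, 'm) mod_functor \<Rightarrow> bool" where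
  "noetherian_module C A M \<longleftrightarrow>
     (\<forall>N. ix_submodule C A M N \<longrightarrow> fin_gen C A (restrict_module M N))"

section \<open>Colimits along the standard inclusions\<close>

text \<open>
  The colimit of a direct system of sets \<open>X n\<close> with transition maps \<open>t m n\<close> is the quotient of the
  disjoint union by eventual equality.
\<close>

definition dl_rel ::
  "(nat \<Rightarrow> 'x set) \<Rightarrow> (nat \<Rightarrow> nat \<Rightarrow> 'x \<Rightarrow> 'x) \<Rightarrow> (nat \<times> 'x) rel" where
  "dl_rel X t = {((m, x), (n, y)). x \<in> X m \<and> y \<in> X n \<and>
     (\<exists>k \<ge> max m n. t m k x = t n k y)}"

definition dl_class ::
  "(nat \<Rightarrow> 'x set) \<Rightarrow> (nat \<Rightarrow> nat \<Rightarrow> 'x \<Rightarrow> 'x) \<Rightarrow> nat \<Rightarrow> 'x \<Rightarrow> (nat \<times> 'x) set" where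
  "dl_class X t m x = dl_rel X t `` {(m, x)}"

definition incl :: "nat \<Rightarrow> nat \<Rightarrow> nat" where
  "incl m = (\<lambda>j\<in>{1..m}. j)"

text \<open>
  Operations on classes are written as unions over all representatives; each union is over
  a single class, because the operations do not depend on the representatives.
\<close>

abbreviation alg_n :: "'o ix_cat \<Rightarrow> ('o, 'k, 'a) alg_functor \<Rightarrow> nat \<Rightarrow> ('k, 'a) module" where
  "alg_n C A n \<equiv> alg_ob A (std C n)"

definition alg_trans ::
  "'o ix_cat \<Rightarrow> ('o, 'k, 'a) alg_functor \<Rightarrow> nat \<Rightarrow> nat \<Rightarrow> 'a \<Rightarrow> 'a" where
  "alg_trans C A m n = alg_map A (std C m) (std C n) (incl m)"

definition alg_class ::
  "'o ix_cat \<Rightarrow> ('o, 'k, 'a) alg_functor \<Rightarrow> nat \<Rightarrow> 'a \<Rightarrow> (nat \<times> 'a) set" where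
  "alg_class C A = dl_class (\<lambda>n. carrier (alg_n C A n)) (alg_trans C A)"

definition lim_algebra ::
  "'o ix_cat \<Rightarrow> ('o, 'k, 'a) alg_functor \<Rightarrow> ('k, (nat \<times> 'a) set) module" where
  "lim_algebra C A =
    \<lparr> carrier = (SIGMA n:UNIV. carrier (alg_n C A n))
                  // dl_rel (\<lambda>n. carrier (alg_n C A n)) (alg_trans C A),
      monoid.mult = (\<lambda>X Y. \<Union>(m, a)\<in>X. \<Union>(n, b)\<in>Y. let k = max m n in
                alg_class C A k (alg_trans C A m k a \<otimes>\<^bsub>alg_n C A k\<^esub> alg_trans C A n k b)),
      one = alg_class C A 0 \<one>\<^bsub>alg_n C A 0\<^esub>,
      zero = alg_class C A 0 \<zero>\<^bsub>alg_n C A 0\<^esub>,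
      add = (\<lambda>X Y. \<Union>(m, a)\<in>X. \<Union>(n, b)\<in>Y. let k = max m n in
                alg_class C A k (alg_trans C A m k a \<oplus>\<^bsub>alg_n C A k\<^esub> alg_trans C A n k b)),
      smult = (\<lambda>c X. \<Union>(m, a)\<in>X. alg_class C A m (c \<odot>\<^bsub>alg_n C A m\<^esub> a)) \<rparr>"

abbreviation mod_n ::
  "'o ix_cat \<Rightarrow> ('o, 'k, 'a, 'm) mod_functor \<Rightarrow> nat \<Rightarrow> ('a, 'm) module" where
  "mod_n C M n \<equiv> amod M (std C n)"

definition mod_trans ::
  "'o ix_cat \<Rightarrow> ('o, 'k, 'a, 'm) mod_functor \<Rightarrow> nat \<Rightarrow> nat \<Rightarrow> 'm \<Rightarrow> 'm" where
  "mod_trans C M m n = mod_map M (std C m) (std C n) (incl m)"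

definition mod_class ::
  "'o ix_cat \<Rightarrow> ('o, 'k, 'a, 'm) mod_functor \<Rightarrow> nat \<Rightarrow> 'm \<Rightarrow> (nat \<times> 'm) set" where
  "mod_class C M = dl_class (\<lambda>n. carrier (mod_n C M n)) (mod_trans C M)"

text \<open>
  The fields \<^const>\<open>mult\<close> and \<^const>\<open>one\<close> of the record type play no role for modules.
\<close>

definition lim_module ::
  "'o ix_cat \<Rightarrow> ('o, 'k, 'a) alg_functor \<Rightarrow> ('o, 'k, 'a, 'm) mod_functor
     \<Rightarrow> ((nat \<times> 'a) set, (nat \<times> 'm) set) module" where
  "lim_module C A M =
    \<lparr> carrier = (SIGMA n:UNIV. carrier (mod_n C M n))
                  // dl_rel (\<lambda>n. carrier (mod_n C M n)) (mod_trans C M),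
      monoid.mult = undefined,
      one = undefined,
      zero = mod_class C M 0 \<zero>\<^bsub>mod_n C M 0\<^esub>,
      add = (\<lambda>X Y. \<Union>(m, p)\<in>X. \<Union>(n, q)\<in>Y. let k = max m n in
                mod_class C M k (mod_trans C M m k p \<oplus>\<^bsub>mod_n C M k\<^esub> mod_trans C M n k q)),
      smult = (\<lambda>X Y. \<Union>(m, a)\<in>X. \<Union>(n, q)\<in>Y. let k = max m n in
                mod_class C M k (alg_trans C A m k a \<odot>\<^bsub>mod_n C M k\<^esub> mod_trans C M n k q)) \<rparr>"

section \<open>The actions of Inc(N) and Sym(infinity) on the colimit\<close>

text \<open>
  The positive integers are \<^term>\<open>{1..} :: nat set\<close>; elements of \<open>Inc_N\<close> are undefined at \<open>0\<close>, and
  those of \<open>Sym_inf\<close> fix \<open>0\<close>.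
\<close>

definition Inc_N :: "(nat \<Rightarrow> nat) set" where
  "Inc_N = {\<pi> \<in> {1..} \<rightarrow>\<^sub>E {1..}. \<forall>i \<ge> 1. \<pi> i < \<pi> (i + 1)}"

definition Sym_inf :: "(nat \<Rightarrow> nat) set" where
  "Sym_inf = (\<Union>n\<in>{1..}. {\<pi>. \<pi> permutes {1..n}})"

text \<open>
  The parameter \<open>l\<close> below selects the target of \<open>j \<mapsto> \<pi> j\<close> on \<^term>\<open>{1..m::nat}\<close>, namely
  \<^term>\<open>{1..l \<pi> m :: nat}\<close>.
\<close>

definition Inc_top :: "(nat \<Rightarrow> nat) \<Rightarrow> nat \<Rightarrow> nat" where
  "Inc_top \<pi> m = \<pi> m"

definition Sym_top :: "(nat \<Rightarrow> nat) \<Rightarrow> nat \<Rightarrow> nat" where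
  "Sym_top \<pi> m = (LEAST l. \<pi> ` {1..m} \<subseteq> {1..l})"

definition lim_act ::
  "'o ix_cat \<Rightarrow> ((nat \<Rightarrow> nat) \<Rightarrow> nat \<Rightarrow> nat) \<Rightarrow> ('o, 'k, 'a, 'm) mod_functor
     \<Rightarrow> (nat \<Rightarrow> nat) \<Rightarrow> (nat \<times> 'm) set \<Rightarrow> (nat \<times> 'm) set" where
  "lim_act C l M \<pi> X =
     (\<Union>(m, q)\<in>{(m, q) \<in> X. m \<ge> 1}.
        mod_class C M (l \<pi> m) (mod_map M (std C m) (std C (l \<pi> m)) (\<lambda>j\<in>{1..m}. \<pi> j) q))"

definition Pi_noetherian ::
  "(nat \<Rightarrow> nat) set \<Rightarrow> ((nat \<Rightarrow> nat) \<Rightarrow> nat \<Rightarrow> nat)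
     \<Rightarrow> 'o ix_cat \<Rightarrow> ('o, 'k, 'a) alg_functor \<Rightarrow> ('o, 'k, 'a, 'm) mod_functor \<Rightarrow> bool" where
  "Pi_noetherian P l C A M \<longleftrightarrow>
     (\<forall>N. submodule N (lim_algebra C A) (lim_module C A M) \<and>
          (\<forall>\<pi> \<in> P. \<forall>x \<in> N. lim_act C l M \<pi> x \<in> N) \<longrightarrow>
        (\<exists>F. finite F \<and> F \<subseteq> carrier (lim_module C A M) \<and>
          N = \<Inter>{H. submodule H (lim_algebra C A) (lim_module C A M) \<and>
                  (\<Union>x\<in>F. {lim_act C l M \<pi> x | \<pi>. \<pi> \<in> P}) \<subseteq> H}))"

abbreviation "OI_module \<equiv> ix_module OI"
abbreviation "FI_module \<equiv> ix_module FI"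
abbreviation "Inc_noetherian \<equiv> Pi_noetherian Inc_N Inc_top OI"
abbreviation "Sym_noetherian \<equiv> Pi_noetherian Sym_inf Sym_top FI"

end

theory Submission
  imports Defs
begin

text \<open>
  Submodules of \<open>lim M\<close> can be pulled back to the functor \<open>M\<close>.  For a submodule \<open>H\<close> of \<open>lim M\<close>,
  let \<open>pullback H S\<close> consist of those \<open>q \<in> M S\<close> all of whose images under maps from \<open>S\<close> to an
  interval \<open>[n]\<close> have their class in \<open>H\<close>.  Quantifying over all maps makes this family stable
  under every morphism (\<open>pullback_submodule\<close>), and the inclusions show that an element of \<open>pullback H [n]\<close> has its
  class in \<open>H\<close> (\<open>pullback_mem_class\<close>).  Conversely, every morphism \<open>[m] \<rightarrow> [n]\<close> with \<open>m \<ge> 1\<close> is the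
  restriction of some \<open>\<pi>\<close> in the acting monoid, followed by an inclusion.  Inclusions do not change
  classes, so the images of \<open>q\<close> under all morphisms \<open>[m] \<rightarrow> [n]\<close> have their classes in the
  orbit of \<open>[q]\<close>; hence \<open>q \<in> pullback H [m]\<close> as soon as \<open>H\<close> contains that orbit
  (\<open>pullback_std\<close>).

  Now let \<open>N\<close> be an invariant submodule.  By noetherianity \<open>pullback N\<close> is generated by a finite set
  \<open>G\<close>, and the orbits of the classes of the elements of \<open>G\<close> generate \<open>N\<close>: if a submodule \<open>H\<close>
  contains these orbits, then \<open>pullback (N \<inter> H)\<close> is a submodule of \<open>pullback N\<close> containing \<open>G\<close>, so
  the two are equal.  Since \<open>N\<close> is invariant, each of its elements is the class of an element of \<open>pullback N\<close>,
  and therefore lies in \<open>H\<close>.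

  The only facts about the index category and the acting monoid that enter are collected in the
  locale \<open>pi_index\<close>, which has OI with \<open>Inc(N)\<close> and FI with \<open>Sym(\<infinity>)\<close> as instances.
\<close>

section \<open>Direct limits of sets\<close>

locale direct_system =
  fixes X :: "nat \<Rightarrow> 'x set" and t :: "nat \<Rightarrow> nat \<Rightarrow> 'x \<Rightarrow> 'x"
  assumes t_closed: "\<lbrakk>m \<le> n; x \<in> X m\<rbrakk> \<Longrightarrow> t m n x \<in> X n"
    and t_id: "x \<in> X n \<Longrightarrow> t n n x = x"
    and t_comp: "\<lbrakk>m \<le> n; n \<le> k; x \<in> X m\<rbrakk> \<Longrightarrow> t n k (t m n x) = t m k x"
begin

lemma agree_later:
  assumes "x \<in> X m" "y \<in> X n" "m \<le> k" "n \<le> k" "t m k x = t n k y" "k \<le> k'"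
  shows "t m k' x = t n k' y"
  using t_comp[of m k k' x] t_comp[of n k k' y] assms by simp

lemma equiv_dl_rel: "equiv (SIGMA n:UNIV. X n) (dl_rel X t)"
proof (rule equivI)
  show "dl_rel X t \<subseteq> (SIGMA n:UNIV. X n) \<times> (SIGMA n:UNIV. X n)"
    by (auto simp: dl_rel_def)
  show "refl_on (SIGMA n:UNIV. X n) (dl_rel X t)"
    by (auto simp: refl_on_def dl_rel_def)
  show "sym (dl_rel X t)"
    by (auto simp: sym_def dl_rel_def)
  show "trans (dl_rel X t)"
  proof (rule transI, clarsimp simp: dl_rel_def)
    fix m x n y p z k k'
    assume x: "x \<in> X m" and y: "y \<in> X n" and z: "z \<in> X p"
      and k: "m \<le> k" "n \<le> k" "t m k x = t n k y" 
      and k': "n \<le> k'" "p \<le> k'" "t n k' y = t p k' z"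
    have "t m (max k k') x = t n (max k k') y" "t n (max k k') y = t p (max k k') z"
      using agree_later[OF x y k] agree_later[OF y z k'] by auto
    then show "\<exists>j. m \<le> j \<and> p \<le> j \<and> t m j x = t p j z"
      using k k' by (intro exI[of _ "max k k'"]) auto
  qed
qed

lemma class_eqI:
  assumes "x \<in> X m" "y \<in> X n" "m \<le> k" "n \<le> k" "t m k x = t n k y"
  shows "dl_class X t m x = dl_class X t n y"
  unfolding dl_class_def
  by (rule equiv_class_eq[OF equiv_dl_rel]) (use assms in \<open>auto simp: dl_rel_def\<close>)

lemma class_trans:
  assumes "m \<le> n" "x \<in> X m"
  shows "dl_class X t n (t m n x) = dl_class X t m x"
  using assms by (intro class_eqI[where k = n]) (auto simp: t_closed t_id)

lemma class_closed: "x \<in> X m \<Longrightarrow> dl_class X t m x \<in> (SIGMA n:UNIV. X n) // dl_rel X t"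
  unfolding dl_class_def by (rule quotientI) simp

lemma class_cases:
  assumes "Z \<in> (SIGMA n:UNIV. X n) // dl_rel X t"
  obtains m x where "x \<in> X m" "Z = dl_class X t m x"
  using assms unfolding dl_class_def by (auto elim!: quotientE)

lemma class_self: "x \<in> X m \<Longrightarrow> (m, x) \<in> dl_class X t m x"
  by (auto simp: dl_class_def dl_rel_def)

lemma mem_classE:
  assumes "(n, y) \<in> dl_class X t m x"
  obtains k where "x \<in> X m" "y \<in> X n" "m \<le> k" "n \<le> k" "t m k x = t n k y"
  using assms by (auto simp: dl_class_def dl_rel_def)

end

text \<open>
  An operation that is defined level by level and commutes with the transition maps does not
  depend on representatives: any two pairs of representatives agree at a common later level.
  Addition and scalar multiplication of the colimit are both of this kind.
\<close>

lemma UN_class_op: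
  fixes Y :: "nat \<Rightarrow> 'y set" and X :: "nat \<Rightarrow> 'x set"
  assumes "direct_system Y s" and "direct_system X t"
    and cl: "\<And>n a x. \<lbrakk>a \<in> Y n; x \<in> X n\<rbrakk> \<Longrightarrow> h n a x \<in> X n"
    and nat: "\<And>m n a x. \<lbrakk>m \<le> n; a \<in> Y m; x \<in> X m\<rbrakk> \<Longrightarrow> t m n (h m a x) = h n (s m n a) (t m n x)"
    and a: "a \<in> Y n" and x: "x \<in> X n"
  shows "(\<Union>(i, b)\<in>dl_class Y s n a. \<Union>(j, y)\<in>dl_class X t n x. let k = max i j in
            dl_class X t k (h k (s i k b) (t j k y))) = dl_class X t n (h n a x)"
proof -
  interpret Y: direct_system Y s by fact
  interpret X: direct_system X t by fact
  have eq: "dl_class X t (max i j) (h (max i j) (s i (max i j) b) (t j (max i j) y))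
             = dl_class X t n (h n a x)"
    if ib: "(i, b) \<in> dl_class Y s n a" and jy: "(j, y) \<in> dl_class X t n x" for i b j y
  proof -
    obtain k where b: "b \<in> Y i" and k: "n \<le> k" "i \<le> k" "s n k a = s i k b"
      using ib by (rule Y.mem_classE)
    obtain k' where y: "y \<in> X j" and k': "n \<le> k'" "j \<le> k'" "t n k' x = t j k' y"
      using jy by (rule X.mem_classE)
    define l where "l = max k k'"
    have l: "n \<le> l" "i \<le> l" "j \<le> l" "s n l a = s i l b" "t n l x = t j l y"
      using Y.agree_later[OF a b k, of l] X.agree_later[OF x y k', of l] k k' by (auto simp: l_def)
    have "t (max i j) l (h (max i j) (s i (max i j) b) (t j (max i j) y)) = h l (s i l b) (t j l y)"
      using l b y by (simp add: nat Y.t_closed X.t_closed Y.t_comp X.t_comp)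
    also have "\<dots> = t n l (h n a x)"
      using l a x by (simp add: nat)
    finally show ?thesis
      using l a b x y by (intro X.class_eqI[where k = l]) (auto intro!: cl simp: Y.t_closed X.t_closed)
  qed
  show ?thesis
  proof -
    let ?c = "dl_class X t n (h n a x)"
    have "(\<Union>(j, y)\<in>dl_class X t n x. let k = max i j in
            dl_class X t k (h k (s i k b) (t j k y))) = ?c" if "(i, b) \<in> dl_class Y s n a" for i b
      using eq[OF that]
      by (intro UN_constant_eq[OF X.class_self[OF x]]) (auto simp: Let_def)
    then show ?thesis
      by (intro UN_constant_eq[OF Y.class_self[OF a]]) (auto split: prod.splits)
  qed
qed

section \<open>Index categories with a monoid acting on the positive integers\<close>

text \<open>
  The last assumption is the decisive one: it turns the images of an element under all morphisms
  between intervals into a single orbit.  It needs \<open>m \<ge> 1\<close> because the action is computed from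
  representatives on nonempty intervals, where \<open>l \<pi> m\<close> is a meaningful target.
\<close>

locale pi_index =
  fixes C :: "'o ix_cat" and P :: "(nat \<Rightarrow> nat) set" and l :: "(nat \<Rightarrow> nat) \<Rightarrow> nat \<Rightarrow> nat"
  assumes std_Obj: "std C n \<in> Obj C"
    and pts_std: "pts C (std C n) = {1..n}"
    and Hom_funcset: "\<lbrakk>S \<in> Obj C; T \<in> Obj C; f \<in> Hom C S T\<rbrakk> \<Longrightarrow> f \<in> pts C S \<rightarrow>\<^sub>E pts C T"
    and Hom_id: "S \<in> Obj C \<Longrightarrow> (\<lambda>x\<in>pts C S. x) \<in> Hom C S S"
    and Hom_compose: "\<lbrakk>S \<in> Obj C; T \<in> Obj C; U \<in> Obj C; f \<in> Hom C S T; g \<in> Hom C T U\<rbrakk>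
      \<Longrightarrow> compose (pts C S) g f \<in> Hom C S U"
    and Hom_incl: "m \<le> n \<Longrightarrow> incl m \<in> Hom C (std C m) (std C n)"
    and Hom_restrict: "\<lbrakk>\<pi> \<in> P; 1 \<le> m\<rbrakk> \<Longrightarrow> restrict \<pi> {1..m} \<in> Hom C (std C m) (std C (l \<pi> m))"
    and top_mono: "\<lbrakk>\<pi> \<in> P; 1 \<le> m; m \<le> n\<rbrakk> \<Longrightarrow> l \<pi> m \<le> l \<pi> n"
    and Hom_extend: "\<lbrakk>1 \<le> m; f \<in> Hom C (std C m) (std C n)\<rbrakk>
      \<Longrightarrow> \<exists>\<pi>\<in>P. l \<pi> m \<le> n \<and> restrict \<pi> {1..m} = f"

lemma pi_index_OI: "pi_index OI Inc_N Inc_top"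
proof
  fix n show "std OI n \<in> Obj OI"
    by (auto simp: OI_def linear_order_on_def partial_order_on_def preorder_on_def refl_on_def
        trans_def antisym_def total_on_def)
next
  fix n show "pts OI (std OI n) = {1..n}" by (simp add: OI_def)
next
  fix S T f assume "S \<in> Obj OI" "T \<in> Obj OI" "f \<in> Hom OI S T"
  then show "f \<in> pts OI S \<rightarrow>\<^sub>E pts OI T" by (auto simp: OI_def split: prod.splits)
next
  fix S assume "S \<in> Obj OI"
  then obtain A r where S: "S = (A, r)" "linear_order_on A r" by (auto simp: OI_def)
  then have "r \<subseteq> A \<times> A"
    by (auto simp: linear_order_on_def partial_order_on_def preorder_on_def)
  then show "(\<lambda>x\<in>pts OI S. x) \<in> Hom OI S S"
    using S by (auto simp: OI_def inj_on_def)
next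
  fix S T U f g
  assume "S \<in> Obj OI" and *: "T \<in> Obj OI" "U \<in> Obj OI" "f \<in> Hom OI S T" "g \<in> Hom OI T U"
  then obtain A r where S: "S = (A, r)" "linear_order_on A r" by (auto simp: OI_def)
  then have "r \<subseteq> A \<times> A"
    by (auto simp: linear_order_on_def partial_order_on_def preorder_on_def)
  moreover obtain A' r' where "T = (A', r')" by fastforce
  moreover obtain A'' r'' where "U = (A'', r'')" by fastforce
  ultimately show "compose (pts OI S) g f \<in> Hom OI S U"
    using S * by (fastforce simp: OI_def compose_def PiE_iff inj_on_def)
next
  fix m n :: nat assume "m \<le> n"
  then show "incl m \<in> Hom OI (std OI m) (std OI n)"
    by (auto simp: OI_def incl_def inj_on_def)
next
  fix \<pi> and m :: nat assume \<pi>: "\<pi> \<in> Inc_N" and m: "1 \<le> m"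
  have mono: "\<pi> i < \<pi> j" if "1 \<le> i" "i < j" for i j
    using that(2,1) \<pi> by (induction rule: less_Suc_induct) (auto simp: Inc_N_def)
  then have mono': "\<pi> i \<le> \<pi> j" if "1 \<le> i" "i \<le> j" for i j
    using that by (cases "i = j") (auto simp: order_less_imp_le)
  have "restrict \<pi> {1..m} \<in> {1..m} \<rightarrow>\<^sub>E {1..\<pi> m}"
  proof (rule restrict_PiE_iff[THEN iffD2], rule ballI)
    fix i assume "i \<in> {1..m}"
    then show "\<pi> i \<in> {1..\<pi> m}" using \<pi> mono'[of i m] by (simp add: Inc_N_def PiE_iff)
  qed
  moreover have "inj_on (restrict \<pi> {1..m}) {1..m}"
    by (intro strict_mono_on_imp_inj_on) (simp add: strict_mono_on_def mono)
  moreover have "\<forall>(i, j) \<in> {(i, j). i \<in> {1..m} \<and> j \<in> {1..m} \<and> i \<le> j}.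
      (restrict \<pi> {1..m} i, restrict \<pi> {1..m} j)
        \<in> {(i, j). i \<in> {1..\<pi> m} \<and> j \<in> {1..\<pi> m} \<and> i \<le> j}"
    using calculation(1) mono' by (auto simp: PiE_iff)
  ultimately show "restrict \<pi> {1..m} \<in> Hom OI (std OI m) (std OI (Inc_top \<pi> m))"
    by (simp only: OI_def Inc_top_def ix_cat.simps prod.case mem_Collect_eq simp_thms)
next
  fix \<pi> and m n :: nat assume \<pi>: "\<pi> \<in> Inc_N" and m: "1 \<le> m" "m \<le> n"
  show "Inc_top \<pi> m \<le> Inc_top \<pi> n"
    unfolding Inc_top_def
    using m(2)
  proof (induction rule: dec_induct)
    case (step k)
    have "\<pi> k < \<pi> (k + 1)" using \<pi> m step by (simp add: Inc_N_def)
    then show ?case using step by simp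
  qed simp
next
  fix m n :: nat and f assume m: "1 \<le> m" and "f \<in> Hom OI (std OI m) (std OI n)"
  then have f: "f \<in> {1..m} \<rightarrow>\<^sub>E {1..n}" "inj_on f {1..m}"
      and le: "\<And>i j. \<lbrakk>1 \<le> i; i \<le> j; j \<le> m\<rbrakk> \<Longrightarrow> f i \<le> f j"
    by (auto simp: OI_def)
  have less: "f i < f (i + 1)" if "1 \<le> i" "i + 1 \<le> m" for i
    using le[of i "i + 1"] inj_onD[OF f(2), of i "i + 1"] that by fastforce
  \<comment> \<open>Past \<open>m\<close>, continue with slope one from the value at \<open>m\<close>, which keeps \<open>\<pi>\<close> strictly increasing.\<close>
  define \<pi> where "\<pi> = (\<lambda>j\<in>{1..}. if j \<le> m then f j else f m + (j - m))"
  have "1 \<le> f j" if "1 \<le> j" "j \<le> m" for j using f that by (auto simp: PiE_iff)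
  then have "\<pi> \<in> {1..} \<rightarrow>\<^sub>E {1..}" using m by (auto simp: \<pi>_def)
  moreover have "\<pi> i < \<pi> (i + 1)" if "1 \<le> i" for i
    using less[of i] that by (cases "i = m") (auto simp: \<pi>_def)
  ultimately have "\<pi> \<in> Inc_N" by (auto simp: Inc_N_def)
  moreover have "Inc_top \<pi> m \<le> n" using f m by (auto simp: Inc_top_def \<pi>_def PiE_iff)
  moreover have "restrict \<pi> {1..m} = f"
    using f by (auto simp: \<pi>_def restrict_def PiE_iff extensional_def fun_eq_iff)
  ultimately show "\<exists>\<pi>\<in>Inc_N. Inc_top \<pi> m \<le> n \<and> restrict \<pi> {1..m} = f" by blast
qed

text \<open>
  The complements of a set and of its injective image in a finite set have the same size; any
  bijection between them completes the injection to a permutation.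
\<close>

lemma inj_on_extend_permutes:
  assumes "finite B" "A \<subseteq> B" "f ` A \<subseteq> B" "inj_on f A"
  obtains p where "p permutes B" "\<And>x. x \<in> A \<Longrightarrow> p x = f x"
proof -
  have "card (B - A) = card (B - f ` A)"
    using assms by (simp add: card_Diff_subset finite_subset card_image)
  then obtain g where g: "bij_betw g (B - A) (B - f ` A)"
    using assms(1) finite_same_card_bij[of "B - A" "B - f ` A"] by auto
  define p where "p x = (if x \<in> A then f x else if x \<in> B then g x else x)" for x
  have "bij_betw p A (f ` A)"
    using assms(4) by (auto simp: p_def bij_betw_def inj_on_def)
  moreover have "bij_betw p (B - A) (B - f ` A)"
    using g by (subst bij_betw_cong[where g = g]) (auto simp: p_def)
  ultimately have "bij_betw p (A \<union> (B - A)) (f ` A \<union> (B - f ` A))"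
    by (rule bij_betw_combine) auto
  moreover have "A \<union> (B - A) = B" "f ` A \<union> (B - f ` A) = B" using assms by auto
  ultimately have "p permutes B"
    using assms(2) by (intro bij_imp_permutes) (auto simp: p_def)
  then show thesis by (rule that) (simp add: p_def)
qed

lemma Sym_inf_image_bounded:
  assumes "\<pi> \<in> Sym_inf"
  shows "\<pi> ` {1..m} \<subseteq> {1..Sym_top \<pi> m}"
proof -
  obtain n where n: "\<pi> permutes {1..n}" using assms by (auto simp: Sym_inf_def)
  have "\<pi> permutes {1..max m n}" using n by (rule permutes_subset) auto
  then have "\<pi> ` {1..m} \<subseteq> {1..max m n}" using permutes_image by fastforce
  then show ?thesis unfolding Sym_top_def by (rule LeastI)
qed

lemma pi_index_FI: "pi_index FI Sym_inf Sym_top"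
proof
  fix n show "std FI n \<in> Obj FI" by (simp add: FI_def)
next
  fix n show "pts FI (std FI n) = {1..n}" by (simp add: FI_def)
next
  fix S T f assume "S \<in> Obj FI" "T \<in> Obj FI" "f \<in> Hom FI S T"
  then show "f \<in> pts FI S \<rightarrow>\<^sub>E pts FI T" by (auto simp: FI_def)
next
  fix S assume "S \<in> Obj FI"
  then show "(\<lambda>x\<in>pts FI S. x) \<in> Hom FI S S" by (auto simp: FI_def inj_on_def)
next
  fix S T U f g
  assume "S \<in> Obj FI" "T \<in> Obj FI" "U \<in> Obj FI" "f \<in> Hom FI S T" "g \<in> Hom FI T U"
  then show "compose (pts FI S) g f \<in> Hom FI S U"
    by (auto simp: FI_def compose_def PiE_iff inj_on_def)
next
  fix m n :: nat assume "m \<le> n"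
  then show "incl m \<in> Hom FI (std FI m) (std FI n)"
    by (auto simp: FI_def incl_def inj_on_def)
next
  fix \<pi> and m :: nat assume \<pi>: "\<pi> \<in> Sym_inf"
  then have "inj \<pi>" by (auto simp: Sym_inf_def intro: permutes_inj)
  then show "restrict \<pi> {1..m} \<in> Hom FI (std FI m) (std FI (Sym_top \<pi> m))"
    using Sym_inf_image_bounded[OF \<pi>, of m] by (auto simp: FI_def inj_on_def)
next
  fix \<pi> and m n :: nat assume \<pi>: "\<pi> \<in> Sym_inf" and "m \<le> n"
  then have "\<pi> ` {1..m} \<subseteq> {1..Sym_top \<pi> n}" using Sym_inf_image_bounded[OF \<pi>, of n] by fastforce
  then show "Sym_top \<pi> m \<le> Sym_top \<pi> n" unfolding Sym_top_def[of \<pi> m] by (rule Least_le)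
next
  fix m n :: nat and f assume m: "1 \<le> m" and "f \<in> Hom FI (std FI m) (std FI n)"
  then have f: "f \<in> {1..m} \<rightarrow>\<^sub>E {1..n}" "inj_on f {1..m}" by (auto simp: FI_def)
  have "card {1..m} \<le> card {1..n}" using f by (intro card_inj_on_le[of f]) auto
  then have mn: "m \<le> n" by simp
  have img: "f ` {1..m} \<subseteq> {1..n}" using f by auto
  obtain \<pi> where \<pi>: "\<pi> permutes {1..n}" "\<And>x. x \<in> {1..m} \<Longrightarrow> \<pi> x = f x"
    using inj_on_extend_permutes[of "{1..n}" "{1..m}" f] f img mn by auto
  have "\<pi> \<in> Sym_inf" using \<pi>(1) m mn by (auto simp: Sym_inf_def)
  moreover have "\<pi> ` {1..m} \<subseteq> {1..n}" using \<pi>(2) img by auto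
  then have "Sym_top \<pi> m \<le> n" unfolding Sym_top_def by (rule Least_le)
  moreover have "restrict \<pi> {1..m} = f"
    using f \<pi>(2) by (auto simp: restrict_def PiE_iff extensional_def fun_eq_iff)
  ultimately show "\<exists>\<pi>\<in>Sym_inf. Sym_top \<pi> m \<le> n \<and> restrict \<pi> {1..m} = f" by blast
qed

section \<open>The colimit of a module\<close>

lemma carrier_amod [simp]: "carrier (amod M S) = carrier (kmod M S)"
  and add_amod [simp]: "add (amod M S) = add (kmod M S)"
  and zero_amod [simp]: "zero (amod M S) = zero (kmod M S)"
  and smult_amod [simp]: "smult (amod M S) = act M S"
  by (simp_all add: amod_def)

locale pi_module = pi_index C P l + ix_module C K A M
  for C :: "'o ix_cat" and P l and K :: "('k, 'z) ring_scheme"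
    and A :: "('o, 'k, 'a) alg_functor" and M :: "('o, 'k, 'a, 'm) mod_functor"
begin

lemma compose_id_right:
  assumes "S \<in> Obj C" "T \<in> Obj C" "f \<in> Hom C S T"
  shows "compose (pts C S) f (\<lambda>x\<in>pts C S. x) = f"
  using Hom_funcset[OF assms] by (auto simp: compose_def fun_eq_iff PiE_iff extensional_def)

lemma compose_incl:
  assumes "S \<in> Obj C" "f \<in> Hom C S (std C m)"
  shows "compose (pts C S) (incl m) f = f"
  using Hom_funcset[OF assms(1) std_Obj assms(2)]
  by (auto simp: compose_def fun_eq_iff PiE_iff extensional_def incl_def pts_std)

lemma mod_map_closed:
  assumes "S \<in> Obj C" "T \<in> Obj C" "f \<in> Hom C S T" "q \<in> carrier (kmod M S)"
  shows "mod_map M S T f q \<in> carrier (kmod M T)"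
  using mod_map_hom[OF assms(1-3)] assms(4) by (auto simp: lin_hom_def)

lemma mod_map_add:
  assumes "S \<in> Obj C" "T \<in> Obj C" "f \<in> Hom C S T" "p \<in> carrier (kmod M S)" "q \<in> carrier (kmod M S)"
  shows "mod_map M S T f (p \<oplus>\<^bsub>kmod M S\<^esub> q) = mod_map M S T f p \<oplus>\<^bsub>kmod M T\<^esub> mod_map M S T f q"
  using mod_map_hom[OF assms(1-3)] assms(4-) by (auto simp: lin_hom_def)

lemma mod_map_zero:
  assumes "S \<in> Obj C" "T \<in> Obj C" "f \<in> Hom C S T"
  shows "mod_map M S T f \<zero>\<^bsub>kmod M S\<^esub> = \<zero>\<^bsub>kmod M T\<^esub>"
proof -
  interpret S: module K "kmod M S" using assms by (intro kmodule)
  interpret T: module K "kmod M T" using assms by (intro kmodule)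
  let ?z = "mod_map M S T f \<zero>\<^bsub>kmod M S\<^esub>"
  have "?z \<in> carrier (kmod M T)" using assms by (simp add: mod_map_closed)
  moreover have "?z \<oplus>\<^bsub>kmod M T\<^esub> ?z = ?z"
    using mod_map_add[OF assms, of "\<zero>\<^bsub>kmod M S\<^esub>" "\<zero>\<^bsub>kmod M S\<^esub>"] by simp
  ultimately show ?thesis using T.add.r_cancel_one by blast
qed

lemma alg_map_closed:
  assumes "S \<in> Obj C" "T \<in> Obj C" "f \<in> Hom C S T" "a \<in> carrier (alg_ob A S)"
  shows "alg_map A S T f a \<in> carrier (alg_ob A T)"
  using map_hom[OF assms(1-3)] assms(4) by (auto simp: alg_hom_def ring_hom_def)

text \<open>
  The compatibility axiom for the action speaks of scalars coming from a source object; taking that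
  object to be \<open>S\<close> itself, with the identity map, gives semilinearity.
\<close>

lemma mod_map_semilinear:
  assumes "S \<in> Obj C" "T \<in> Obj C" "f \<in> Hom C S T" "a \<in> carrier (alg_ob A S)"
    "q \<in> carrier (kmod M S)"
  shows "mod_map M S T f (act M S a q) = act M T (alg_map A S T f a) (mod_map M S T f q)"
  using mod_map_act[OF assms(1,1,2) Hom_id assms(3-)] assms
  by (simp add: map_id compose_id_right)

lemma act_closed:
  assumes "S \<in> Obj C" "a \<in> carrier (alg_ob A S)" "q \<in> carrier (kmod M S)"
  shows "act M S a q \<in> carrier (kmod M S)"
  using module.smult_closed[OF amodule[OF assms(1)], of a q] assms by simp

lemma direct_system_mod: "direct_system (\<lambda>n. carrier (mod_n C M n)) (mod_trans C M)"
proof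
  fix m n x assume "m \<le> n" "x \<in> carrier (mod_n C M m)"
  then show "mod_trans C M m n x \<in> carrier (mod_n C M n)"
    by (simp add: mod_trans_def mod_map_closed std_Obj Hom_incl)
next
  fix n x assume "x \<in> carrier (mod_n C M n)"
  then show "mod_trans C M n n x = x"
    using mod_map_id[OF std_Obj, of x n] by (simp add: mod_trans_def incl_def pts_std)
next
  fix m n k x assume "m \<le> n" "n \<le> k" "x \<in> carrier (mod_n C M m)"
  then show "mod_trans C M n k (mod_trans C M m n x) = mod_trans C M m k x"
    by (simp add: mod_trans_def mod_map_comp[symmetric] std_Obj Hom_incl compose_incl)
qed

lemma direct_system_alg: "direct_system (\<lambda>n. carrier (alg_n C A n)) (alg_trans C A)"
proof
  fix m n x assume "m \<le> n" "x \<in> carrier (alg_n C A m)"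
  then show "alg_trans C A m n x \<in> carrier (alg_n C A n)"
    by (simp add: alg_trans_def alg_map_closed std_Obj Hom_incl)
next
  fix n x assume "x \<in> carrier (alg_n C A n)"
  then show "alg_trans C A n n x = x"
    using map_id[OF std_Obj, of x n] by (simp add: alg_trans_def incl_def pts_std)
next
  fix m n k x assume "m \<le> n" "n \<le> k" "x \<in> carrier (alg_n C A m)"
  then show "alg_trans C A n k (alg_trans C A m n x) = alg_trans C A m k x"
    by (simp add: alg_trans_def map_comp[symmetric] std_Obj Hom_incl compose_incl)
qed

lemma lim_add_class:
  assumes "p \<in> carrier (kmod M (std C n))" "q \<in> carrier (kmod M (std C n))"
  shows "mod_class C M n p \<oplus>\<^bsub>lim_module C A M\<^esub> mod_class C M n q
    = mod_class C M n (p \<oplus>\<^bsub>kmod M (std C n)\<^esub> q)"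
proof -
  have "p \<oplus>\<^bsub>kmod M (std C n)\<^esub> q \<in> carrier (kmod M (std C n))"
    if "p \<in> carrier (kmod M (std C n))" "q \<in> carrier (kmod M (std C n))" for n p q
    using abelian_monoid.a_closed[of "kmod M (std C n)"] kmodule[OF std_Obj, of n] that
    by (auto simp: module_def abelian_group_def)
  then show ?thesis
    using UN_class_op[OF direct_system_mod direct_system_mod,
        where h = "\<lambda>n p q. p \<oplus>\<^bsub>kmod M (std C n)\<^esub> q"] assms
    by (simp add: lim_module_def mod_class_def mod_trans_def mod_map_add std_Obj Hom_incl)
qed

lemma lim_smult_class:
  assumes "a \<in> carrier (alg_n C A n)" "q \<in> carrier (kmod M (std C n))"
  shows "alg_class C A n a \<odot>\<^bsub>lim_module C A M\<^esub> mod_class C M n q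
    = mod_class C M n (act M (std C n) a q)"
  using UN_class_op[OF direct_system_alg direct_system_mod,
      where h = "\<lambda>n. act M (std C n)"] assms
  by (simp add: lim_module_def mod_class_def alg_class_def mod_trans_def alg_trans_def
      mod_map_semilinear act_closed std_Obj Hom_incl)

text \<open>
  Enlarging the target interval of a morphism amounts to a further transition map of the colimit.
\<close>

lemma mod_class_map:
  assumes "S \<in> Obj C" "f \<in> Hom C S (std C m)" "m \<le> n" "q \<in> carrier (kmod M S)"
  shows "mod_class C M n (mod_map M S (std C n) f q) = mod_class C M m (mod_map M S (std C m) f q)"
  using direct_system.class_trans[OF direct_system_mod assms(3), of "mod_map M S (std C m) f q"] assms
  by (simp add: mod_class_def mod_trans_def mod_map_closed std_Obj Hom_incl compose_incl
      mod_map_comp[symmetric])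

text \<open>
  Restricting \<open>\<pi>\<close> to a larger interval and then precomposing with the inclusion is restricting to the
  smaller one; so passing to a later representative only enlarges the target \<open>l \<pi> m\<close>, which is
  monotone in \<open>m\<close>.  This makes the union defining the action range over a single class.
\<close>

lemma lim_act_class:
  assumes \<pi>: "\<pi> \<in> P" and m: "1 \<le> m" and q: "q \<in> carrier (kmod M (std C m))"
  shows "lim_act C l M \<pi> (mod_class C M m q)
    = mod_class C M (l \<pi> m) (mod_map M (std C m) (std C (l \<pi> m)) (restrict \<pi> {1..m}) q)"
proof -
  interpret D: direct_system "\<lambda>n. carrier (mod_n C M n)" "mod_trans C M"
    by (rule direct_system_mod)
  define \<phi> where "\<phi> n y =
    mod_class C M (l \<pi> n) (mod_map M (std C n) (std C (l \<pi> n)) (restrict \<pi> {1..n}) y)" for n y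
  have \<phi>_trans: "\<phi> k (mod_trans C M n k y) = \<phi> n y"
    if "1 \<le> n" "n \<le> k" "y \<in> carrier (kmod M (std C n))" for n k y
  proof -
    have top: "l \<pi> n \<le> l \<pi> k" using \<pi> that by (intro top_mono)
    have comp: "compose {1..n} (restrict \<pi> {1..k}) (incl n) = restrict \<pi> {1..n}"
      using that by (auto simp: compose_def incl_def fun_eq_iff)
    have "\<phi> k (mod_trans C M n k y)
        = mod_class C M (l \<pi> k) (mod_map M (std C n) (std C (l \<pi> k)) (restrict \<pi> {1..n}) y)"
      using mod_map_comp[OF std_Obj std_Obj std_Obj Hom_incl[OF that(2)] Hom_restrict[OF \<pi>] that(3)]
        that comp by (simp add: \<phi>_def mod_trans_def pts_std)
    also have "\<dots> = \<phi> n y"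
      unfolding \<phi>_def
      by (rule mod_class_map[OF std_Obj Hom_restrict[OF \<pi> that(1)] top that(3)])
    finally show ?thesis .
  qed
  have "\<phi> n y = \<phi> m q" if ny: "(n, y) \<in> mod_class C M m q" and n: "1 \<le> n" for n y
  proof -
    obtain k where "y \<in> carrier (mod_n C M n)" "m \<le> k" "n \<le> k"
      "mod_trans C M m k q = mod_trans C M n k y"
      using ny unfolding mod_class_def by (rule D.mem_classE)
    then show ?thesis using \<phi>_trans[of n k y] \<phi>_trans[of m k q] n m q by simp
  qed
  moreover have "(m, q) \<in> mod_class C M m q"
    unfolding mod_class_def using q by (intro D.class_self) simp
  ultimately have "(\<Union>(n, y)\<in>{(n, y) \<in> mod_class C M m q. n \<ge> 1}. \<phi> n y) = \<phi> m q"
    using m by (intro UN_constant_eq[where a = "(m, q)" and f = "\<lambda>(n, y). \<phi> n y" and c = "\<phi> m q"]) blast+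
  then show ?thesis by (simp add: lim_act_def \<phi>_def)
qed

section \<open>Submodules of the functor from submodules of the colimit\<close>

text \<open>
  A submodule of the colimit enters the argument only through its closure properties at each fixed
  level.  Unlike the notion of submodule, these clauses are inherited by intersections without
  any knowledge of additive inverses in the colimit.
\<close>

definition levelwise_closed :: "(nat \<times> 'm) set set \<Rightarrow> bool" where
  "levelwise_closed H \<longleftrightarrow>
     (\<forall>n. mod_class C M n \<zero>\<^bsub>kmod M (std C n)\<^esub> \<in> H) \<and>
     (\<forall>n. \<forall>p\<in>carrier (kmod M (std C n)). \<forall>q\<in>carrier (kmod M (std C n)).
        mod_class C M n p \<in> H \<longrightarrow> mod_class C M n q \<in> H \<longrightarrow>
        mod_class C M n (p \<oplus>\<^bsub>kmod M (std C n)\<^esub> q) \<in> H) \<and>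
     (\<forall>n. \<forall>a\<in>carrier (alg_n C A n). \<forall>q\<in>carrier (kmod M (std C n)).
        mod_class C M n q \<in> H \<longrightarrow> mod_class C M n (act M (std C n) a q) \<in> H)"

lemma levelwise_closed_Int:
  "\<lbrakk>levelwise_closed H; levelwise_closed H'\<rbrakk> \<Longrightarrow> levelwise_closed (H \<inter> H')"
  unfolding levelwise_closed_def by blast

lemma submodule_levelwise_closed:
  assumes "submodule H (lim_algebra C A) (lim_module C A M)"
  shows "levelwise_closed H"
proof -
  interpret H: submodule H "lim_algebra C A" "lim_module C A M" by fact
  interpret D: direct_system "\<lambda>n. carrier (mod_n C M n)" "mod_trans C M"
    by (rule direct_system_mod)
  have z: "\<zero>\<^bsub>kmod M (std C n)\<^esub> \<in> carrier (kmod M (std C n))" for n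
    using abelian_monoid.zero_closed[of "kmod M (std C n)"] kmodule[OF std_Obj, of n]
    by (auto simp: module_def abelian_group_def)
  have "mod_class C M 0 \<zero>\<^bsub>kmod M (std C 0)\<^esub> \<in> H"
    using H.one_closed by (simp add: lim_module_def)
  then have zero: "mod_class C M n \<zero>\<^bsub>kmod M (std C n)\<^esub> \<in> H" for n
    using D.class_trans[of 0 n "\<zero>\<^bsub>kmod M (std C 0)\<^esub>"] z
    by (simp add: mod_class_def mod_trans_def mod_map_zero std_Obj Hom_incl)
  have "alg_class C A n a \<in> carrier (lim_algebra C A)" if "a \<in> carrier (alg_n C A n)" for n a
    using direct_system.class_closed[OF direct_system_alg, of a n] that
    by (simp add: lim_algebra_def alg_class_def)
  then have smult: "mod_class C M n (act M (std C n) a q) \<in> H"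
    if "a \<in> carrier (alg_n C A n)" "q \<in> carrier (kmod M (std C n))" "mod_class C M n q \<in> H" for n a q
    using H.smult_closed[of "alg_class C A n a" "mod_class C M n q"] that
    by (simp add: lim_smult_class)
  have "mod_class C M n (p \<oplus>\<^bsub>kmod M (std C n)\<^esub> q) \<in> H"
    if "p \<in> carrier (kmod M (std C n))" "q \<in> carrier (kmod M (std C n))"
      "mod_class C M n p \<in> H" "mod_class C M n q \<in> H" for n p q
    using H.m_closed[OF that(3,4)] that by (simp add: lim_add_class)
  then show ?thesis using zero smult by (auto simp: levelwise_closed_def)
qed

text \<open>
  Requiring only that the class of \<open>q\<close> itself lies in \<open>H\<close> would make sense on intervals alone and
  would fail to be stable under morphisms when \<open>H\<close> is not invariant.
\<close>

definition pullback :: "(nat \<times> 'm) set set \<Rightarrow> 'o \<Rightarrow> 'm set" where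
  "pullback H S = {q \<in> carrier (kmod M S).
     \<forall>n. \<forall>f\<in>Hom C S (std C n). mod_class C M n (mod_map M S (std C n) f q) \<in> H}"

text \<open>
  Module operations are transported by the maps to intervals, where \<open>H\<close> is closed levelwise;
  composites of morphisms to an interval are again such morphisms.  Inverses come from multiplying
  by \<open>-1\<close>.
\<close>

lemma pullback_submodule:
  assumes "levelwise_closed H"
  shows "ix_submodule C A M (pullback H)"
  unfolding ix_submodule_def
proof (intro conjI ballI)
  fix S assume S: "S \<in> Obj C"
  interpret S: module "alg_ob A S" "amod M S" by (rule amodule[OF S])
  have smult: "a \<odot>\<^bsub>amod M S\<^esub> q \<in> pullback H S"
    if "a \<in> carrier (alg_ob A S)" "q \<in> pullback H S" for a q
    using that assms S
    by (auto simp: pullback_def levelwise_closed_def mod_map_semilinear alg_map_closed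
        mod_map_closed act_closed std_Obj)
  show "submodule (pullback H S) (alg_ob A S) (amod M S)"
  proof (rule S.submoduleI)
    show "pullback H S \<subseteq> carrier (amod M S)" by (auto simp: pullback_def)
    show "\<zero>\<^bsub>amod M S\<^esub> \<in> pullback H S"
      using assms S S.M.zero_closed
      by (auto simp: pullback_def levelwise_closed_def mod_map_zero std_Obj)
    fix p assume p: "p \<in> pullback H S"
    then have "\<ominus>\<^bsub>amod M S\<^esub> p = (\<ominus>\<^bsub>alg_ob A S\<^esub> \<one>\<^bsub>alg_ob A S\<^esub>) \<odot>\<^bsub>amod M S\<^esub> p"
      using S.smult_l_minus[OF S.one_closed, of p] S.smult_one[of p] by (simp add: pullback_def)
    then show "\<ominus>\<^bsub>amod M S\<^esub> p \<in> pullback H S" using smult p by simp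
    fix q assume q: "q \<in> pullback H S"
    show "p \<oplus>\<^bsub>amod M S\<^esub> q \<in> pullback H S"
      using p q assms S S.M.a_closed[of p q]
      by (auto simp: pullback_def levelwise_closed_def mod_map_add mod_map_closed std_Obj)
  qed (rule smult)
next
  fix S T f assume "S \<in> Obj C" "T \<in> Obj C" "f \<in> Hom C S T"
  then show "mod_map M S T f ` pullback H S \<subseteq> pullback H T"
    by (auto simp: pullback_def mod_map_closed mod_map_comp[symmetric] std_Obj Hom_compose)
qed

lemma pullback_mem_class:
  assumes "q \<in> pullback H (std C n)"
  shows "mod_class C M n q \<in> H"
proof -
  have "mod_map M (std C n) (std C n) (incl n) q = q"
    using mod_map_id[OF std_Obj, of q n] assms by (simp add: pullback_def incl_def pts_std)
  moreover have "mod_class C M n (mod_map M (std C n) (std C n) (incl n) q) \<in> H"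
    using assms Hom_incl[of n n] by (simp add: pullback_def)
  ultimately show ?thesis by simp
qed

text \<open>
  A morphism out of \<open>[m]\<close> is the restriction of some \<open>\<pi>\<close> up to enlarging the target, so its effect on
  the class of \<open>q\<close> is that of \<open>\<pi>\<close>.
\<close>

lemma pullback_std_pos:
  assumes q: "q \<in> carrier (kmod M (std C m))" and m: "1 \<le> m"
    and orb: "\<And>\<pi>. \<pi> \<in> P \<Longrightarrow> lim_act C l M \<pi> (mod_class C M m q) \<in> H"
  shows "q \<in> pullback H (std C m)"
proof -
  have "mod_class C M n (mod_map M (std C m) (std C n) f q) \<in> H"
    if f: "f \<in> Hom C (std C m) (std C n)" for n f
  proof -
    obtain \<pi> where \<pi>: "\<pi> \<in> P" "l \<pi> m \<le> n" "restrict \<pi> {1..m} = f"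
      using Hom_extend[OF m f] by blast
    have "mod_class C M n (mod_map M (std C m) (std C n) f q) = lim_act C l M \<pi> (mod_class C M m q)"
      using mod_class_map[OF std_Obj Hom_restrict[OF \<pi>(1) m] \<pi>(2) q] lim_act_class[OF \<pi>(1) m q] \<pi>(3)
      by simp
    then show ?thesis using orb \<pi>(1) by simp
  qed
  then show ?thesis using q by (simp add: pullback_def)
qed

text \<open>
  On the empty interval the action is defined by moving to a positive level first.  There is only
  one map from \<open>[0]\<close> to \<open>[n]\<close>, so it is enough that the class of \<open>q\<close> lies in \<open>H\<close>, which follows
  from the positive case applied to the image of \<open>q\<close> at level 1.
\<close>

lemma pullback_std:
  assumes q: "q \<in> carrier (kmod M (std C m))"
    and orb: "\<And>\<pi>. \<pi> \<in> P \<Longrightarrow> lim_act C l M \<pi> (mod_class C M m q) \<in> H"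
  shows "q \<in> pullback H (std C m)"
proof (cases "1 \<le> m")
  case True
  then show ?thesis using pullback_std_pos assms by blast
next
  case False
  then have m: "m = 0" by simp
  interpret D: direct_system "\<lambda>n. carrier (mod_n C M n)" "mod_trans C M"
    by (rule direct_system_mod)
  have eq: "mod_class C M n (mod_trans C M 0 n q) = mod_class C M 0 q" for n
    unfolding mod_class_def using q m by (intro D.class_trans) auto
  have "mod_trans C M 0 1 q \<in> pullback H (std C 1)"
    using D.t_closed[of 0 1 q] q orb m eq[of 1] by (intro pullback_std_pos) auto
  then have H: "mod_class C M 0 q \<in> H" using pullback_mem_class eq[of 1] by fastforce
  have "f = incl 0" if "f \<in> Hom C (std C 0) (std C n)" for f n
    using Hom_funcset[OF std_Obj std_Obj that] by (auto simp: pts_std incl_def restrict_def)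
  then show ?thesis using q m H eq by (fastforce simp: pullback_def mod_trans_def)
qed

lemma ix_submodule_restrict:
  assumes N: "ix_submodule C A M N" and N': "ix_submodule C A M N'"
    and sub: "\<And>S. S \<in> Obj C \<Longrightarrow> N' S \<subseteq> N S"
  shows "ix_submodule C A (restrict_module M N) N'"
  unfolding ix_submodule_def
proof (intro conjI ballI)
  fix S assume S: "S \<in> Obj C"
  have eq: "amod (restrict_module M N) S = (amod M S)\<lparr>carrier := N S\<rparr>"
    by (simp add: amod_def restrict_module_def)
  have "module (alg_ob A S) ((amod M S)\<lparr>carrier := N S\<rparr>)"
    using N S by (auto simp: ix_submodule_def intro: submodule.submodule_is_module amodule)
  moreover have "module (alg_ob A S) ((amod M S)\<lparr>carrier := N' S\<rparr>)"
    using N' S by (auto simp: ix_submodule_def intro: submodule.submodule_is_module amodule)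
  ultimately show "submodule (N' S) (alg_ob A S) (amod (restrict_module M N) S)"
    unfolding eq using sub[OF S] by (intro module.module_incl_imp_submodule) auto
next
  fix S T f assume "S \<in> Obj C" "T \<in> Obj C" "f \<in> Hom C S T"
  then show "mod_map (restrict_module M N) S T f ` N' S \<subseteq> N' T"
    using N' by (auto simp: ix_submodule_def restrict_module_def)
qed

text \<open>
  The generators of \<open>N\<close> are the classes of generators of its pullback.  The pullback of \<open>N \<inter> H\<close>,
  rather than of \<open>H\<close>, is compared with that of \<open>N\<close> so as to stay inside the module to which finite
  generation applies.
\<close>

theorem lim_Pi_noetherian:
  assumes noeth: "noetherian_module C A M"
  shows "Pi_noetherian P l C A M"
  unfolding Pi_noetherian_def
proof (intro allI impI, elim conjE)
  fix N
  assume N: "submodule N (lim_algebra C A) (lim_module C A M)"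
    and inv: "\<forall>\<pi>\<in>P. \<forall>x\<in>N. lim_act C l M \<pi> x \<in> N"
  interpret D: direct_system "\<lambda>n. carrier (mod_n C M n)" "mod_trans C M"
    by (rule direct_system_mod)
  have cN: "levelwise_closed N" by (rule submodule_levelwise_closed[OF N])
  have fg: "fin_gen C A (restrict_module M (pullback N))"
    using noeth pullback_submodule[OF cN] by (simp add: noetherian_module_def)
  obtain G where G: "finite G" "G \<subseteq> (SIGMA n:UNIV. pullback N (std C n))"
    and gen: "\<And>N' S. \<lbrakk>ix_submodule C A (restrict_module M (pullback N)) N';
        G \<subseteq> (SIGMA n:UNIV. N' (std C n)); S \<in> Obj C\<rbrakk> \<Longrightarrow> N' S = pullback N S"
  proof -
    have [simp]: "carrier (kmod (restrict_module M (pullback N)) S) = pullback N S" for S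
      by (simp add: restrict_module_def)
    from fg obtain G where "finite G" "G \<subseteq> (SIGMA n:UNIV. pullback N (std C n))"
      and "\<not> (\<exists>N'. ix_submodule C A (restrict_module M (pullback N)) N' \<and>
        (\<exists>S\<in>Obj C. N' S \<noteq> pullback N S) \<and> G \<subseteq> (SIGMA n:UNIV. N' (std C n)))"
      by (simp add: fin_gen_def) blast
    then show thesis by (intro that) blast+
  qed
  define F where "F = (\<lambda>(n, q). mod_class C M n q) ` G"
  have FN: "F \<subseteq> N"
    unfolding F_def using G(2) by (auto intro!: pullback_mem_class)
  have "N \<subseteq> carrier (lim_module C A M)"
    using N by (auto simp: submodule_def subgroup_def)
  then have F: "finite F" "F \<subseteq> carrier (lim_module C A M)"
    using G(1) FN by (auto simp: F_def)
  have "N \<subseteq> H"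
    if H: "submodule H (lim_algebra C A) (lim_module C A M)"
      and orb: "(\<Union>x\<in>F. {lim_act C l M \<pi> x | \<pi>. \<pi> \<in> P}) \<subseteq> H" for H
  proof
    fix x assume x: "x \<in> N"
    have cH: "levelwise_closed (N \<inter> H)"
      by (intro levelwise_closed_Int cN submodule_levelwise_closed H)
    have "ix_submodule C A (restrict_module M (pullback N)) (pullback (N \<inter> H))"
      by (intro ix_submodule_restrict pullback_submodule cN cH) (auto simp: pullback_def)
    moreover have "G \<subseteq> (SIGMA n:UNIV. pullback (N \<inter> H) (std C n))"
    proof clarsimp
      fix n q assume "(n, q) \<in> G"
      then have "q \<in> carrier (kmod M (std C n))" "mod_class C M n q \<in> F"
        using G(2) by (auto simp: pullback_def F_def)
      then show "q \<in> pullback (N \<inter> H) (std C n)"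
        using FN orb inv by (intro pullback_std) auto
    qed
    ultimately have eq: "pullback (N \<inter> H) (std C n) = pullback N (std C n)" for n
      using gen std_Obj by blast
    have "x \<in> (SIGMA n:UNIV. carrier (mod_n C M n))
        // dl_rel (\<lambda>n. carrier (mod_n C M n)) (mod_trans C M)"
      using x \<open>N \<subseteq> carrier _\<close> by (auto simp: lim_module_def simp del: carrier_amod)
    then obtain n q where "q \<in> carrier (mod_n C M n)" and xq: "x = mod_class C M n q"
      unfolding mod_class_def by (rule D.class_cases)
    then have q: "q \<in> carrier (kmod M (std C n))" by simp
    then have "q \<in> pullback N (std C n)" using x xq inv by (intro pullback_std) auto
    then show "x \<in> H" using eq xq pullback_mem_class by blast
  qed
  moreover have "(\<Union>x\<in>F. {lim_act C l M \<pi> x | \<pi>. \<pi> \<in> P}) \<subseteq> N" using FN inv by auto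
  ultimately have "N = \<Inter>{H. submodule H (lim_algebra C A) (lim_module C A M) \<and>
      (\<Union>x\<in>F. {lim_act C l M \<pi> x | \<pi>. \<pi> \<in> P}) \<subseteq> H}"
    using N by blast
  then show "\<exists>F. finite F \<and> F \<subseteq> carrier (lim_module C A M) \<and>
      N = \<Inter>{H. submodule H (lim_algebra C A) (lim_module C A M) \<and>
        (\<Union>x\<in>F. {lim_act C l M \<pi> x | \<pi>. \<pi> \<in> P}) \<subseteq> H}"
    using F by blast
qed

end

section \<open>The cases OI and FI\<close>

theorem theorem4p6:
  fixes K :: "'k ring"
    and A :: "(nat set \<times> nat rel, 'k, 'a) alg_functor"
    and M :: "(nat set \<times> nat rel, 'k, 'a, 'm) mod_functor"
    and B :: "(nat set, 'k, 'b) alg_functor"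
    and P :: "(nat set, 'k, 'b, 'p) mod_functor"
  assumes "cring K"
  shows "(OI_module K A M \<and> noetherian_module OI A M \<longrightarrow> Inc_noetherian A M) \<and>
         (FI_module K B P \<and> noetherian_module FI B P \<longrightarrow> Sym_noetherian B P)"
proof (intro conjI impI; elim conjE)
  assume "OI_module K A M" "noetherian_module OI A M"
  then show "Inc_noetherian A M"
    by (intro pi_module.lim_Pi_noetherian pi_module.intro pi_index_OI)
next
  assume "FI_module K B P" "noetherian_module FI B P"
  then show "Sym_noetherian B P"
    by (intro pi_module.lim_Pi_noetherian pi_module.intro pi_index_FI)
qed

end
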